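(* Let $d\ge 3$ be a fixed integer and $p^*=(d-1)^{-1}$. Suppose that $p=p(n)\in(0,1)$ is such that $$\lim_{n\to\infty} n^{1/3}(p^*-p)=\infty .$$ Then $$\frac{L_n^{(1)}}{(p^*-p)^{-2}\log n}$$ is bounded in probability, i.e. $L_n^{(1)}=O_P\big((p^*-p)^{-2}\log n\big)$.
   Context: $d\ge3$ is fixed, $n>d$ with $nd$ even; limits are taken as $n\to\infty$ through such values. $G_n$ is a uniformly random (simple, labelled) $d$-regular graph on the vertex set $[n]=\{1,\dots,n\}$. Given $p\in(0,1)$, $q=1-p$, $G_{np}$ is the random subgraph of $G_n$ (on the vertex set $[n]$) obtained by declaring each edge of $G_n$ open with probability $p$ and closed with probability $q$, independently of all other edges, and keeping exactly the open edges. $L_n^{(1)}$ is the number of vertices of the largest connected component of $G_{np}$. A sequence $X_n$ is bounded in probability if for every $\varepsilon>0$ there is $M<\infty$ such that $P(|X_n|>M)\le\varepsilon$ for all sufficiently large $n$. *)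

theory Defs
  imports "HOL-Probability.Probability"
begin

text \<open>A graph on a vertex set \<open>V\<close> is represented by its set of edges, each edge being a
  two-element subset of \<open>V\<close>; thus graphs are simple, labelled and undirected.\<close>

definition complete_edges :: "'a set \<Rightarrow> 'a set set" where
  "complete_edges V = {e. e \<subseteq> V \<and> card e = 2}"

definition degree :: "'a set set \<Rightarrow> 'a \<Rightarrow> nat" where
  "degree E v = card {e \<in> E. v \<in> e}"

definition regular_graphs :: "nat \<Rightarrow> nat \<Rightarrow> nat set set set" where
  "regular_graphs n d = {E. E \<subseteq> complete_edges {1..n} \<and> (\<forall>v\<in>{1..n}. degree E v = d)}"

definition adj :: "'a set set \<Rightarrow> ('a \<times> 'a) set" where
  "adj E = {(u, v). {u, v} \<in> E}"

definition components :: "'a set \<Rightarrow> 'a set set \<Rightarrow> 'a set set" where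
  "components V E = (\<lambda>u. {v \<in> V. (u, v) \<in> (adj E)\<^sup>*}) ` V"

definition largest_component :: "'a set \<Rightarrow> 'a set set \<Rightarrow> nat" where
  "largest_component V E = Max (card ` components V E)"

definition percolation :: "real \<Rightarrow> 'a set set \<Rightarrow> 'a set set pmf" where
  "percolation p E =
     map_pmf (\<lambda>is_open. {e \<in> E. is_open e}) (Pi_pmf E False (\<lambda>_. bernoulli_pmf p))"

text \<open>The set \<open>regular_graphs n d\<close> is finite, and it is nonempty if \<open>n > d\<close> and \<open>n * d\<close> is even;
  outside this range the distribution below is meaningless, so it must only be used for
  \<open>n\<close> in \<open>admissible d\<close>.\<close>

definition random_regular_percolation :: "nat \<Rightarrow> nat \<Rightarrow> real \<Rightarrow> nat set set pmf" where
  "random_regular_percolation n d p = pmf_of_set (regular_graphs n d) \<bind> percolation p"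

definition admissible :: "nat \<Rightarrow> nat set" where
  "admissible d = {n. n > d \<and> even (n * d)}"

definition admissible_at_top :: "nat \<Rightarrow> nat filter" where
  "admissible_at_top d = inf sequentially (principal (admissible d))"

definition bounded_in_probability ::
    "nat filter \<Rightarrow> (nat \<Rightarrow> 'a pmf) \<Rightarrow> (nat \<Rightarrow> 'a \<Rightarrow> real) \<Rightarrow> bool" where
  "bounded_in_probability F P X \<longleftrightarrow>
     (\<forall>\<epsilon>>0. \<exists>M. \<forall>\<^sub>F n in F. measure_pmf.prob (P n) {\<omega>. \<bar>X n \<omega>\<bar> > M} \<le> \<epsilon>)"

end

theory Submission imports Defs begin

text \<open>
  The bound holds for each \<open>d\<close>-regular graph separately, so the randomness of the graph only has
  to be averaged out at the end. Exploring the open cluster of a vertex edge by edge, every newly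
  found vertex brings at most \<open>d - 1\<close> unexplored edges, so the cluster is no larger than the total
  progeny of a branching process whose offspring, from the second generation on, has mean at most
  \<open>(d - 1) p = 1 - \<eta>\<close>, where \<open>\<eta> = (d - 1) (p\<^sup>* - p) > 0\<close>. Such a total progeny has an exponential
  moment \<open>z = exp (\<eta>\<^sup>2 / 4)\<close>: it suffices that \<open>z (1 + p \<delta>)\<^bsup>d - 1\<^esup> \<le> 1 + \<delta>\<close>
  for some \<open>\<delta> \<ge> 0\<close>, and \<open>\<delta> = \<eta> / 2\<close> will do (\<open>subcritical_weight\<close>).

  The comparison with the branching process is carried out without constructing one:
  \<open>reach_generating_function_bound\<close> proves the resulting bound on the generating function of the
  cluster size directly, by induction on the number of edges, revealing one edge at the cluster in
  each step. Cycles do no harm, since an edge between two vertices already reached can only be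
  wasted.

  Markov's inequality turns this into \<open>P(|C(v)| \<ge> k) \<le> 4 exp (- \<eta>\<^sup>2 k / 4)\<close>
  (\<open>cluster_tail\<close>), and a union bound costs a factor \<open>n\<close>. As \<open>\<eta>\<^sup>2 \<ge> 4 (p\<^sup>* - p)\<^sup>2\<close>, the choice
  \<open>k = 2 (p\<^sup>* - p)\<^bsup>-2\<^esup> log n\<close> makes the total at most \<open>4 / n\<close>.
\<close>

section \<open>Vertices reachable from a set\<close>

definition reach :: "'a set set \<Rightarrow> 'a set \<Rightarrow> 'a set" where
  "reach E A = (adj E)\<^sup>* `` A"

lemma reach_closed: "(u, v) \<in> adj E \<Longrightarrow> u \<in> reach E A \<Longrightarrow> v \<in> reach E A"
  unfolding reach_def by (auto intro: rtrancl_into_rtrancl)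

lemma subset_reach: "A \<subseteq> reach E A"
  unfolding reach_def by auto

lemma reach_least:
  assumes "A \<subseteq> S" "\<And>u v. u \<in> S \<Longrightarrow> (u, v) \<in> adj E \<Longrightarrow> v \<in> S"
  shows "reach E A \<subseteq> S"
proof -
  have "(adj E)\<^sup>* `` S = S"
    by (rule Image_closed_trancl) (use assms(2) in auto)
  with assms(1) show ?thesis unfolding reach_def by blast
qed

text \<open>Revealing an open edge at an already reached vertex \<open>a\<close> has the same effect as discarding the
  edge and adding its other end to the starting set. This covers the case \<open>b \<in> A\<close> too.\<close>

lemma reach_insert_edge:
  assumes "a \<in> A"
  shows "reach (insert {a, b} F) A = reach F (insert b A)"
proof
  show "reach (insert {a, b} F) A \<subseteq> reach F (insert b A)"
  proof (rule reach_least)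
    show "A \<subseteq> reach F (insert b A)" using subset_reach[of "insert b A" F] by auto
  next
    fix u v assume u: "u \<in> reach F (insert b A)" and e: "(u, v) \<in> adj (insert {a, b} F)"
    show "v \<in> reach F (insert b A)"
    proof (cases "{u, v} = {a, b}")
      case True
      then have "v \<in> insert b A" using assms by (auto simp: doubleton_eq_iff)
      then show ?thesis using subset_reach by fastforce
    next
      case False
      then have "(u, v) \<in> adj F" using e by (auto simp: adj_def)
      then show ?thesis using u by (rule reach_closed)
    qed
  qed
next
  have a: "a \<in> reach (insert {a, b} F) A" using assms subset_reach by fastforce
  have "b \<in> reach (insert {a, b} F) A" 
    by (rule reach_closed[OF _ a]) (auto simp: adj_def)
  then show "reach F (insert b A) \<subseteq> reach (insert {a, b} F) A"
    using subset_reach[of A "insert {a, b} F"]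
    by (intro reach_least) (auto simp: adj_def intro: reach_closed[unfolded adj_def])
qed

lemma reach_isolated:
  assumes "\<And>e. e \<in> F \<Longrightarrow> e \<inter> A = {}"
  shows "reach F A = A"
proof
  show "reach F A \<subseteq> A"
    by (rule reach_least) (use assms in \<open>auto simp: adj_def\<close>)
qed (rule subset_reach)

section \<open>Revealing one edge of percolation\<close>

lemma set_percolation_subset: "set_pmf (percolation p E) \<subseteq> Pow E"
  unfolding percolation_def by auto

lemma finite_set_percolation: "finite E \<Longrightarrow> finite (set_pmf (percolation p E))"
  by (rule finite_subset[OF set_percolation_subset]) simp

lemma percolation_insert:
  assumes "finite E" "e \<notin> E"
  shows "percolation p (insert e E) =
    bernoulli_pmf p \<bind> (\<lambda>b. map_pmf (if b then insert e else id) (percolation p E))"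
proof -
  have "{x \<in> insert e E. (f(e := b)) x} = (if b then insert e else id) {x \<in> E. f x}" for f b
    using assms(2) by auto
  then show ?thesis
    unfolding percolation_def
    by (simp add: Pi_pmf_insert'[OF assms] map_bind_pmf map_pmf_comp map_pmf_def[symmetric])
qed

lemma expectation_percolation_insert:
  fixes g :: "'a set set \<Rightarrow> real"
  assumes "finite E" "e \<notin> E" "0 \<le> p" "p \<le> 1"
  shows "measure_pmf.expectation (percolation p (insert e E)) g =
    p * measure_pmf.expectation (percolation p E) (\<lambda>F. g (insert e F)) +
    (1 - p) * measure_pmf.expectation (percolation p E) g"
  unfolding percolation_insert[OF assms(1,2)]
  by (subst pmf_expectation_bind[of UNIV])
     (use assms in \<open>auto simp: UNIV_bool finite_set_percolation\<close>)

lemma degree_insert: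
  assumes "finite E" "e \<notin> E"
  shows "degree (insert e E) v = (if v \<in> e then Suc (degree E v) else degree E v)"
proof -
  have "{x \<in> insert e E. v \<in> x} = (if v \<in> e then insert e {x \<in> E. v \<in> x} else {x \<in> E. v \<in> x})"
    by auto
  then show ?thesis using assms by (simp add: degree_def)
qed

section \<open>Exponential moment of a subcritical cluster\<close>

text \<open>Think of the vertices of \<open>A\<close> as reached already and of \<open>E\<close> as the edges not yet revealed.
  The right-hand side gives weight \<open>z\<close> to every reached vertex and weight \<open>1 + p \<delta>\<close> to every
  unrevealed edge at it. Revealing an edge from \<open>a \<in> A\<close> to a new vertex \<open>b\<close> uses up one factor
  \<open>1 + p \<delta> = (1 - p) + p (1 + \<delta>)\<close>: with probability \<open>p\<close> the vertex \<open>b\<close> is added, whose weight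
  is at most \<open>z (1 + p \<delta>)\<^bsup>d - 1\<^esup> \<le> 1 + \<delta>\<close> because one of its at most \<open>d\<close> edges has been
  spent on reaching it. The starting set must be arbitrary for the induction, as it grows with
  every open edge.\<close>

lemma reach_generating_function_bound:
  fixes p \<delta> z :: real
  assumes p: "0 \<le> p" "p \<le> 1" and "\<delta> \<ge> 0" and z: "z \<ge> 0"
    and sup: "z * (1 + p * \<delta>) ^ (d - 1) \<le> 1 + \<delta>"
    and "finite E" "finite A" "\<And>e. e \<in> E \<Longrightarrow> card e = 2" "\<And>v. degree E v \<le> d"
  shows "measure_pmf.expectation (percolation p E) (\<lambda>F. z ^ card (reach F A))
       \<le> (\<Prod>a\<in>A. z * (1 + p * \<delta>) ^ degree E a)"
  using assms(6-)
proof (induction "card E" arbitrary: E A rule: less_induct)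
  case less
  define x where "x = 1 + p * \<delta>"
  have x: "x \<ge> 1" using p \<open>\<delta> \<ge> 0\<close> by (simp add: x_def)
  show ?case
  proof (cases "\<exists>e\<in>E. e \<inter> A \<noteq> {}")
    case False
    have "reach F A = A" if "F \<in> set_pmf (percolation p E)" for F
      using that set_percolation_subset[of p E] False by (intro reach_isolated) blast
    then have "measure_pmf.expectation (percolation p E) (\<lambda>F. z ^ card (reach F A))
        = measure_pmf.expectation (percolation p E) (\<lambda>F. z ^ card A)"
      by (intro integral_cong_AE) (auto simp: AE_measure_pmf_iff)
    moreover have "degree E a = 0" if "a \<in> A" for a
      using False that less.prems(1) by (auto simp: degree_def)
    ultimately show ?thesis by simp
  next
    case True
    then obtain e a where e: "e \<in> E" and a: "a \<in> e" "a \<in> A" by blast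
    then obtain b where eab: "e = {a, b}" and "a \<noteq> b"
      using less.prems(3)[OF e] by (metis card_2_iff doubleton_eq_iff insert_iff singletonD)
    define E' where "E' = E - {e}"
    have E: "E = insert e E'" "finite E'" "e \<notin> E'" 
      using e less.prems(1) by (auto simp: E'_def)
    have deg: "degree E v = (if v \<in> e then Suc (degree E' v) else degree E' v)" for v
      unfolding E(1) using E(2,3) by (rule degree_insert)
    have deg': "degree E' v \<le> d" for v using deg[of v] less.prems(4)[of v] by (auto split: if_splits)
    define Q where "Q B = (\<Prod>v\<in>B. z * x ^ degree E' v)" for B
    have IH: "measure_pmf.expectation (percolation p E') (\<lambda>F. z ^ card (reach F B)) \<le> Q B"
      if "finite B" for B
      unfolding Q_def x_def
      by (rule less.hyps) (use that E less.prems(3) deg' in auto)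
    have Q0: "Q B \<ge> 0" for B unfolding Q_def using z x by (intro prod_nonneg) auto
    \<comment> \<open>If the edge is open, its other end costs a factor of at most \<open>1 + \<delta>\<close>.\<close>
    have "Q (insert b A) \<le> (1 + \<delta>) * Q A"
    proof (cases "b \<in> A")
      case True
      then show ?thesis 
        using Q0[of A] \<open>\<delta> \<ge> 0\<close> by (simp add: insert_absorb mult_le_cancel_right1)
    next
      case False
      have "degree E' b \<le> d - 1" using deg[of b] less.prems(4)[of b] eab by simp
      then have "z * x ^ degree E' b \<le> z * x ^ (d - 1)"
        using x z by (intro mult_left_mono power_increasing)
      then have "z * x ^ degree E' b \<le> 1 + \<delta>" using sup by (simp add: x_def)
      then show ?thesis
        using False less.prems(2) Q0[of A] by (simp add: Q_def mult_right_mono)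
    qed
    then have opn: "measure_pmf.expectation (percolation p E') (\<lambda>F. z ^ card (reach (insert e F) A))
        \<le> (1 + \<delta>) * Q A"
      using IH[of "insert b A"] less.prems(2) unfolding eab reach_insert_edge[OF a(2)] by simp
    have "measure_pmf.expectation (percolation p E) (\<lambda>F. z ^ card (reach F A))
        \<le> p * ((1 + \<delta>) * Q A) + (1 - p) * Q A"
      unfolding E(1) expectation_percolation_insert[OF E(2,3) p]
      using opn IH[OF less.prems(2)] p by (intro add_mono mult_left_mono) auto
    also have "\<dots> = x * Q A" by (simp add: x_def algebra_simps)
    also have "\<dots> = x * (z * x ^ degree E' a) * (\<Prod>v\<in>A - {a}. z * x ^ degree E' v)"
      unfolding Q_def using less.prems(2) a(2) by (simp add: prod.remove mult.assoc)
    also have "\<dots> \<le> (z * x ^ degree E a) * (\<Prod>v\<in>A - {a}. z * x ^ degree E v)"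
    proof (rule mult_mono)
      show "x * (z * x ^ degree E' a) \<le> z * x ^ degree E a" using deg[of a] a(1) by simp
      show "(\<Prod>v\<in>A - {a}. z * x ^ degree E' v) \<le> (\<Prod>v\<in>A - {a}. z * x ^ degree E v)"
        using z x deg by (intro prod_mono conjI mult_left_mono power_increasing) auto
      show "0 \<le> z * x ^ degree E a" "0 \<le> (\<Prod>v\<in>A - {a}. z * x ^ degree E' v)"
        using z x by (auto intro!: prod_nonneg)
    qed
    also have "\<dots> = (\<Prod>v\<in>A. z * x ^ degree E v)"
      using less.prems(2) a(2) by (simp add: prod.remove)
    finally show ?thesis by (simp add: x_def)
  qed
qed

text \<open>To first order the exponents of the two sides differ by \<open>\<delta> - (1 - \<eta>) \<delta> = \<eta> \<delta>\<close> with
  \<open>\<delta> = \<eta> / 2\<close>, and \<open>ln (1 + \<delta>) \<ge> \<delta> - \<delta>\<^sup>2\<close> loses only \<open>\<delta>\<^sup>2\<close> of it; this choice of \<open>\<delta>\<close>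
  maximises the remainder \<open>\<eta> \<delta> - \<delta>\<^sup>2 = \<eta>\<^sup>2 / 4\<close>, which is the exponent left for \<open>z\<close>.\<close>

lemma subcritical_weight:
  fixes p \<eta> :: real
  assumes "d \<ge> 1" "0 \<le> p" "\<eta> = 1 - (real d - 1) * p" "0 \<le> \<eta>" "\<eta> \<le> 1"
  shows "exp (\<eta>\<^sup>2 / 4) * (1 + p * (\<eta> / 2)) ^ (d - 1) \<le> 1 + \<eta> / 2"
proof -
  have "(1 + p * (\<eta> / 2)) ^ (d - 1) \<le> exp (p * (\<eta> / 2)) ^ (d - 1)"
    using assms by (intro power_mono exp_ge_add_one_self) auto
  also have "\<dots> = exp ((1 - \<eta>) * (\<eta> / 2))"
    using assms(1,3) by (simp add: exp_of_nat_mult[symmetric] of_nat_diff)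
  finally have "exp (\<eta>\<^sup>2 / 4) * (1 + p * (\<eta> / 2)) ^ (d - 1)
      \<le> exp (\<eta>\<^sup>2 / 4) * exp ((1 - \<eta>) * (\<eta> / 2))"
    by (intro mult_left_mono) auto
  also have "\<dots> = exp (\<eta> / 2 - (\<eta> / 2)\<^sup>2)"
    unfolding exp_add[symmetric] by (simp add: power2_eq_square field_simps)
  also have "\<dots> \<le> exp (ln (1 + \<eta> / 2))"
    using ln_one_plus_pos_lower_bound[of "\<eta> / 2"] assms by simp
  also have "\<dots> = 1 + \<eta> / 2" using assms(4) by simp
  finally show ?thesis .
qed

section \<open>Tail of the cluster sizes\<close>

text \<open>The starting vertex has up to \<open>d\<close> edges rather than \<open>d - 1\<close>, which costs one more factor
  \<open>1 + p \<eta> / 2 \<le> 2\<close>; this and \<open>1 + \<eta> / 2 \<le> 2\<close> make up the constant \<open>4\<close>.\<close>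

lemma cluster_tail:
  fixes p \<eta> k :: real
  assumes "d \<ge> 2" "0 \<le> p" "p \<le> 1" and \<eta>: "\<eta> = 1 - (real d - 1) * p" "0 \<le> \<eta>" "\<eta> \<le> 1"
    and E: "finite E" "\<And>e. e \<in> E \<Longrightarrow> card e = 2" "\<And>v. degree E v \<le> d"
  shows "measure_pmf.prob (percolation p E) {F. k \<le> real (card (reach F {v}))}
       \<le> 4 * exp (- (\<eta>\<^sup>2 / 4 * k))"
proof -
  define z where "z = exp (\<eta>\<^sup>2 / 4)"
  define x where "x = 1 + p * (\<eta> / 2)"
  have p\<eta>: "0 \<le> p * \<eta>" "p * \<eta> \<le> 1" using assms by (auto intro: mult_le_one)
  have x: "1 \<le> x" "x \<le> 2" using p\<eta> by (auto simp: x_def)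
  have zk: "z ^ m = exp (\<eta>\<^sup>2 / 4 * real m)" for m
    by (simp add: z_def exp_of_nat_mult[symmetric] mult.commute)
  have fin: "finite (set_pmf (percolation p E))" using E(1) by (rule finite_set_percolation)
  have "measure_pmf.expectation (percolation p E) (\<lambda>F. z ^ card (reach F {v}))
      \<le> (\<Prod>a\<in>{v}. z * (1 + p * (\<eta> / 2)) ^ degree E a)"
    using assms(1,2,3) \<eta> subcritical_weight[of d p \<eta>] E
    by (intro reach_generating_function_bound[where d = d]) (auto simp: z_def)
  also have "\<dots> \<le> z * x ^ d"
    using E(3)[of v] x by (auto simp: x_def z_def intro!: power_increasing)
  also have "\<dots> = (z * x ^ (d - 1)) * x"
    using assms(1) by (cases d) auto
  also have "\<dots> \<le> (1 + \<eta> / 2) * 2"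
    using subcritical_weight[of d p \<eta>] assms x by (intro mult_mono) (auto simp: x_def z_def)
  also have "\<dots> \<le> 4" using \<eta> by simp
  finally have mgf: "measure_pmf.expectation (percolation p E) (\<lambda>F. z ^ card (reach F {v})) \<le> 4" .
  have "measure_pmf.prob (percolation p E) {F. k \<le> real (card (reach F {v}))}
      \<le> measure_pmf.prob (percolation p E) {F. exp (\<eta>\<^sup>2 / 4 * k) \<le> z ^ card (reach F {v})}"
    by (intro measure_pmf.finite_measure_mono) (auto simp: zk intro!: mult_left_mono)
  also have "\<dots> \<le> measure_pmf.expectation (percolation p E) (\<lambda>F. z ^ card (reach F {v})) / exp (\<eta>\<^sup>2 / 4 * k)"
    using integral_Markov_inequality_measure[where M = "measure_pmf (percolation p E)" and A = "{}"
        and u = "\<lambda>F. z ^ card (reach F {v})" and c = "exp (\<eta>\<^sup>2 / 4 * k)"]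
    by (auto simp: z_def integrable_measure_pmf_finite[OF fin])
  also have "\<dots> \<le> 4 / exp (\<eta>\<^sup>2 / 4 * k)"
    using mgf by (intro divide_right_mono) auto
  finally show ?thesis by (simp only: exp_minus divide_inverse)
qed

lemma largest_component_tail:
  fixes p \<eta> k :: real
  assumes "d \<ge> 2" "0 \<le> p" "p \<le> 1" and \<eta>: "\<eta> = 1 - (real d - 1) * p" "0 \<le> \<eta>" "\<eta> \<le> 1"
    and V: "finite V" "V \<noteq> {}" and E: "E \<subseteq> complete_edges V" "\<And>v. v \<in> V \<Longrightarrow> degree E v \<le> d"
  shows "measure_pmf.prob (percolation p E) {F. k \<le> real (largest_component V F)}
       \<le> real (card V) * (4 * exp (- (\<eta>\<^sup>2 / 4 * k)))"
proof -
  have finE: "finite E"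
    using E(1) V(1) by (auto simp: complete_edges_def intro: finite_subset[of _ "Pow V"])
  have deg: "degree E v \<le> d" for v
  proof (cases "v \<in> V")
    case False
    then have "{e \<in> E. v \<in> e} = {}" using E(1) by (auto simp: complete_edges_def)
    then show ?thesis unfolding degree_def by (metis card.empty le0)
  qed (rule E(2))
  have "\<exists>v\<in>V. k \<le> real (card (reach F {v}))"
    if F: "F \<in> set_pmf (percolation p E)" and k: "k \<le> real (largest_component V F)" for F
  proof -
    have "largest_component V F \<in> card ` components V F"
      unfolding largest_component_def components_def using V by (intro Max_in) auto
    then obtain v where v: "v \<in> V" "largest_component V F = card {w \<in> V. (v, w) \<in> (adj F)\<^sup>*}"
      by (auto simp: components_def)
    have "F \<subseteq> complete_edges V" using F E(1) set_percolation_subset[of p E] by blast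
    then have "reach F {v} \<subseteq> V"
      using v(1) by (intro reach_least) (auto simp: adj_def complete_edges_def)
    then have "{w \<in> V. (v, w) \<in> (adj F)\<^sup>*} = reach F {v}" by (auto simp: reach_def)
    with v k show ?thesis by auto
  qed
  then have "measure_pmf.prob (percolation p E) {F. k \<le> real (largest_component V F)}
      \<le> measure_pmf.prob (percolation p E) (\<Union>v\<in>V. {F. k \<le> real (card (reach F {v}))})"
    by (intro measure_pmf.finite_measure_mono_AE) (auto simp: AE_measure_pmf_iff)
  also have "\<dots> \<le> (\<Sum>v\<in>V. measure_pmf.prob (percolation p E) {F. k \<le> real (card (reach F {v}))})"
    using V(1) by (intro measure_pmf.finite_measure_subadditive_finite) auto
  also have "\<dots> \<le> (\<Sum>v\<in>V. 4 * exp (- (\<eta>\<^sup>2 / 4 * k)))"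
    using assms(1-3) \<eta> finE deg E(1)
    by (intro sum_mono cluster_tail) (auto simp: complete_edges_def)
  finally show ?thesis by simp
qed

section \<open>Existence of regular graphs\<close>

text \<open>The uniform distribution on an empty set is unspecified, so some \<open>d\<close>-regular graph on \<open>n\<close>
  vertices has to be exhibited. Circulant graphs do: as \<open>u\<close> runs through the vertices, the
  difference \<open>u - v\<close> runs exactly once through the residues modulo \<open>n\<close>, so every vertex has
  \<open>card S\<close> neighbours; symmetry of \<open>S\<close> makes the relation undirected and \<open>0 \<notin> S\<close> excludes loops.\<close>

lemma circulant_regular:
  fixes n :: nat and S :: "int set"
  assumes "n > 0" and S: "S \<subseteq> {1..<int n}" and sym: "\<And>s. s \<in> S \<Longrightarrow> int n - s \<in> S"
  shows "{{u, v} |u v. u \<in> {1..n} \<and> v \<in> {1..n} \<and> (int u - int v) mod int n \<in> S}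
           \<in> regular_graphs n (card S)"
    (is "?E \<in> _")
proof -
  define D where "D u v = (int u - int v) mod int n" for u v :: nat
  have D_sym: "D v u \<in> S" if "D u v \<in> S" for u v
  proof -
    have "D u v \<noteq> 0" using that S by auto
    then have "D v u = int n - D u v"
      unfolding D_def using zmod_zminus1_eq_if[of "int u - int v" "int n"] by simp
    with sym[OF that] show ?thesis by simp
  qed
  have D_irrefl: "D u u \<notin> S" for u using S by (auto simp: D_def)
  have "?E \<subseteq> complete_edges {1..n}"
    using D_irrefl by (fastforce simp: complete_edges_def D_def card_2_iff)
  moreover have "degree ?E v = card S" if v: "v \<in> {1..n}" for v
  proof -
    define N where "N = {u \<in> {1..n}. D u v \<in> S}"
    have "{e \<in> ?E. v \<in> e} = (\<lambda>u. {u, v}) ` N"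
      using v D_sym by (fastforce simp: N_def D_def[symmetric])
    then have "degree ?E v = card ((\<lambda>u. {u, v}) ` N)" by (simp add: degree_def)
    also have "\<dots> = card N"
      by (rule card_image) (auto simp: inj_on_def doubleton_eq_iff)
    also have "\<dots> = card S"
    proof (rule bij_betw_same_card)
      show "bij_betw (\<lambda>u. D u v) N S"
        unfolding bij_betw_def
      proof
        show "inj_on (\<lambda>u. D u v) N"
        proof (rule inj_onI)
          fix u w assume uw: "u \<in> N" "w \<in> N" "D u v = D w v"
          then have "int n dvd int u - int w"
            by (simp add: D_def mod_eq_dvd_iff)
          moreover have "\<bar>int u - int w\<bar> < int n" using uw by (auto simp: N_def)
          ultimately have "int u - int w = 0"
            using dvd_imp_le_int[of "int u - int w" "int n"] by linarith
          then show "u = w" by simp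
        qed
        show "(\<lambda>u. D u v) ` N = S"
        proof
          show "S \<subseteq> (\<lambda>u. D u v) ` N"
          proof
            fix s assume s: "s \<in> S"
            \<comment> \<open>The shift by one accounts for the vertices being \<open>1, \<dots>, n\<close> rather than \<open>0, \<dots>, n - 1\<close>.\<close>
            define u where "u = nat ((int v + s - 1) mod int n + 1)"
            have u: "int u = (int v + s - 1) mod int n + 1" "u \<in> {1..n}"
              using assms(1) pos_mod_bound[of "int n" "int v + s - 1"]
              by (auto simp: u_def nat_le_iff le_nat_iff simp del: pos_mod_bound)
            have "D u v = ((int v + s - 1) mod int n + (1 - int v)) mod int n"
              unfolding D_def u(1) by (simp add: algebra_simps)
            also have "\<dots> = s mod int n" by (simp add: mod_simps)
            also have "\<dots> = s" using s S by (auto intro!: mod_pos_pos_trivial)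
            finally show "s \<in> (\<lambda>u. D u v) ` N" using u(2) s by (auto simp: N_def intro!: image_eqI)
          qed
        qed (auto simp: N_def)
      qed
    qed
    finally show ?thesis .
  qed
  ultimately show ?thesis by (simp add: regular_graphs_def)
qed

text \<open>Each vertex is joined to its nearest \<open>d div 2\<close> vertices on either side of the cycle. If \<open>d\<close>
  is odd, then \<open>n\<close> is even and the antipodal vertex, which is its own mirror image, supplies the
  missing neighbour.\<close>

lemma regular_graphs_nonempty:
  assumes "n \<in> admissible d"
  shows "regular_graphs n d \<noteq> {}"
proof -
  have nd: "n > d" "even (n * d)" using assms by (auto simp: admissible_def)
  define m where "m = int (d div 2)"
  define S0 where "S0 = {1..m} \<union> {int n - m..int n - 1}"
  have m: "0 \<le> m" "2 * m < int n" using nd(1) by (auto simp: m_def)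
  have cS0: "card S0 = 2 * (d div 2)"
    unfolding S0_def using m by (subst card_Un_disjoint) (auto simp: m_def)
  show ?thesis
  proof (cases "even d")
    case True
    have "card S0 = d" using cS0 True by simp
    moreover have "{{u, v} |u v. u \<in> {1..n} \<and> v \<in> {1..n} \<and> (int u - int v) mod int n \<in> S0}
        \<in> regular_graphs n (card S0)"
      by (rule circulant_regular) (use m nd in \<open>auto simp: S0_def\<close>)
    ultimately show ?thesis by auto
  next
    case False
    define S where "S = insert (int (n div 2)) S0"
    have n2: "even n" "int n = 2 * int (n div 2)" using nd(2) False by auto
    have "m < int (n div 2)"
      using nd(1) False n2(1) unfolding m_def by (auto elim!: evenE oddE)
    then have "card S = d" and "int (n div 2) \<ge> 1"
      using cS0 False n2 m unfolding S_def by (auto simp: S0_def)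
    moreover have "{{u, v} |u v. u \<in> {1..n} \<and> v \<in> {1..n} \<and> (int u - int v) mod int n \<in> S}
        \<in> regular_graphs n (card S)"
      by (rule circulant_regular)
         (use m nd n2 \<open>int (n div 2) \<ge> 1\<close> in \<open>auto simp: S_def S0_def\<close>)
    ultimately show ?thesis by auto
  qed
qed

section \<open>The largest component of a percolated random regular graph\<close>

lemma prob_bind_le:
  assumes "\<And>x. x \<in> set_pmf M \<Longrightarrow> measure_pmf.prob (N x) S \<le> c"
  shows "measure_pmf.prob (M \<bind> N) S \<le> c"
proof -
  obtain x0 where "x0 \<in> set_pmf M" using set_pmf_not_empty[of M] by auto
  then have c: "c \<ge> 0" using assms[of x0] measure_nonneg[of "N x0" S] by linarith
  have "emeasure (bind_pmf M N) S \<le> (\<integral>\<^sup>+x. ennreal c \<partial>M)"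
    unfolding emeasure_bind_pmf
    by (intro nn_integral_mono_AE)
       (auto simp: AE_measure_pmf_iff measure_pmf.emeasure_eq_measure assms intro!: ennreal_leI)
  then show ?thesis
    using c by (simp add: measure_pmf.emeasure_eq_measure)
qed

lemma random_regular_tail:
  fixes p \<eta> k :: real
  assumes "d \<ge> 2" "0 \<le> p" "p \<le> 1" "\<eta> = 1 - (real d - 1) * p" "0 \<le> \<eta>" "\<eta> \<le> 1"
    and n: "n \<in> admissible d"
  shows "measure_pmf.prob (random_regular_percolation n d p)
           {F. k \<le> real (largest_component {1..n} F)}
       \<le> real n * (4 * exp (- (\<eta>\<^sup>2 / 4 * k)))"
  unfolding random_regular_percolation_def
proof (rule prob_bind_le)
  fix E assume E: "E \<in> set_pmf (pmf_of_set (regular_graphs n d))"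
  have "finite (regular_graphs n d)"
    by (rule finite_subset[of _ "Pow (Pow {1..n})"])
       (auto simp: regular_graphs_def complete_edges_def)
  then have "E \<in> regular_graphs n d"
    using E regular_graphs_nonempty[OF n] by simp
  then show "measure_pmf.prob (percolation p E) {F. k \<le> real (largest_component {1..n} F)}
       \<le> real n * (4 * exp (- (\<eta>\<^sup>2 / 4 * k)))"
    using largest_component_tail[of d p \<eta> "{1..n}" E k] assms
    by (auto simp: regular_graphs_def admissible_def)
qed

theorem theorem1:
  fixes d :: nat and p :: "nat \<Rightarrow> real" and pstar :: real
  assumes "d \<ge> 3"
    and "pstar = 1 / (real d - 1)"
    and "\<And>n. n \<in> admissible d \<Longrightarrow> 0 < p n \<and> p n < 1"
    and "filterlim (\<lambda>n. real n powr (1 / 3) * (pstar - p n)) at_top (admissible_at_top d)"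
  shows "bounded_in_probability (admissible_at_top d)
           (\<lambda>n. random_regular_percolation n d (p n))
           (\<lambda>n G. real (largest_component {1..n} G) / ((pstar - p n) powi (-2) * ln (real n)))"
  unfolding bounded_in_probability_def
proof (intro allI impI exI[of _ "2 :: real"])
  fix \<epsilon> :: real assume \<epsilon>: "\<epsilon> > 0"
  have pos: "\<forall>\<^sub>F n in admissible_at_top d. 0 < real n powr (1 / 3) * (pstar - p n)"
    using assms(4) by (simp add: filterlim_at_top_dense)
  have "\<forall>\<^sub>F n in sequentially. 4 / real n < \<epsilon>"
    by (rule order_tendstoD(2)[OF lim_const_over_n \<epsilon>])
  then have small: "\<forall>\<^sub>F n in admissible_at_top d. 4 / real n < \<epsilon>"
    unfolding admissible_at_top_def by (rule filter_leD[rotated]) simp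
  have adm: "\<forall>\<^sub>F n in admissible_at_top d. n \<in> admissible d"
    unfolding admissible_at_top_def by (simp add: eventually_inf_principal)
  show "\<forall>\<^sub>F n in admissible_at_top d.
      measure_pmf.prob (random_regular_percolation n d (p n))
        {G. \<bar>real (largest_component {1..n} G) / ((pstar - p n) powi (-2) * ln (real n))\<bar> > 2} \<le> \<epsilon>"
    using pos small adm
  proof eventually_elim
    case (elim n)
    define \<gamma> where "\<gamma> = pstar - p n"
    define \<eta> where "\<eta> = 1 - (real d - 1) * p n"
    define k where "k = 2 * (ln (real n) / \<gamma>\<^sup>2)"
    have \<gamma>: "\<gamma> > 0" using elim(1) by (auto simp: \<gamma>_def zero_less_mult_iff)
    have n: "n \<ge> 4" using elim(3) assms(1) by (simp add: admissible_def)
    have p: "0 < p n" "p n < 1" using assms(3)[OF elim(3)] by auto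
    have \<eta>\<gamma>: "\<eta> = (real d - 1) * \<gamma>"
      using assms(1,2) by (simp add: \<eta>_def \<gamma>_def field_simps)
    have \<eta>: "0 \<le> \<eta>" using \<gamma> assms(1) by (simp add: \<eta>\<gamma>)
    have \<eta>1: "\<eta> \<le> 1" using assms(1) p by (simp add: \<eta>_def)
    have lnn: "ln (real n) > 0" using n by simp
    \<comment> \<open>The exponent \<open>\<eta>\<^sup>2 k / 4\<close> reaches \<open>2 ln n\<close>: one \<open>ln n\<close> pays for the union bound over the
      vertices, the other makes the probability vanish.\<close>
    have "2 \<le> (real d - 1)\<^sup>2 / 2"
      using power_mono[of 2 "real d - 1" 2] assms(1) by simp
    then have "2 * ln (real n) \<le> (real d - 1)\<^sup>2 / 2 * ln (real n)"
      using lnn by (intro mult_right_mono) auto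
    also have "\<dots> = \<eta>\<^sup>2 / 4 * k"
      using \<gamma> by (simp add: \<eta>\<gamma> k_def power_mult_distrib)
    finally have "exp (- (\<eta>\<^sup>2 / 4 * k)) \<le> exp (- (2 * ln (real n)))" by simp
    also have "\<dots> = 1 / (real n)\<^sup>2"
      using n by (simp add: exp_minus exp_double inverse_eq_divide)
    finally have ex: "exp (- (\<eta>\<^sup>2 / 4 * k)) \<le> 1 / (real n)\<^sup>2" .
    have "{G. \<bar>real (largest_component {1..n} G) / (\<gamma> powi (-2) * ln (real n))\<bar> > 2}
        \<subseteq> {G. k \<le> real (largest_component {1..n} G)}"
    proof safe
      fix G assume "\<bar>real (largest_component {1..n} G) / (\<gamma> powi (-2) * ln (real n))\<bar> > 2"
      then have "2 < real (largest_component {1..n} G) * (\<gamma>\<^sup>2 / ln (real n))"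
        using lnn by (simp add: power_int_minus divide_inverse mult_ac)
      then have "k < real (largest_component {1..n} G)"
        using lnn \<gamma> by (simp add: k_def field_simps)
      then show "k \<le> real (largest_component {1..n} G)" by simp
    qed
    then have "measure_pmf.prob (random_regular_percolation n d (p n))
        {G. \<bar>real (largest_component {1..n} G) / (\<gamma> powi (-2) * ln (real n))\<bar> > 2}
      \<le> measure_pmf.prob (random_regular_percolation n d (p n))
          {G. k \<le> real (largest_component {1..n} G)}"
      by (intro measure_pmf.finite_measure_mono) auto
    also have "\<dots> \<le> real n * (4 * exp (- (\<eta>\<^sup>2 / 4 * k)))"
      using assms(1) p \<eta> \<eta>1 elim(3) by (intro random_regular_tail) (auto simp: \<eta>_def)
    also have "\<dots> \<le> real n * (4 * (1 / (real n)\<^sup>2))"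
      using ex by (intro mult_left_mono) auto
    also have "\<dots> = 4 / real n" using n by (simp add: power2_eq_square)
    also have "\<dots> \<le> \<epsilon>" using elim(2) by simp
    finally show ?case by (simp add: \<gamma>_def)
  qed
qed

end
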